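(* Let $0<q<1$, $j\ge1$ and $\mathcal{C}:=\{z\in\mathbb{C}:|z|=1\}$, and let $Q_j(\mathbf{q},\boldsymbol{\sigma})$ and $\widehat{\boldsymbol{\sigma}}=\widehat{\boldsymbol{\sigma}}(\mathbf{q},\boldsymbol{\sigma})$ be as defined in the context, where $\mathbf{q}=(q_i)_{i=1}^j$ with $q_i\in[-q,q]$ and $\boldsymbol{\sigma}=(\sigma_i)_{i=1}^j$ with $\sigma_i\in\mathcal{C}$ for all $1\le i\le j$. (i) It holds $$\max_{\sigma_i\in\mathcal{C},\,1\le i\le j}|Q_j(\mathbf{q},\boldsymbol{\sigma})|=|Q_j(\mathbf{q},\widehat{\boldsymbol{\sigma}})|,$$ i.e., the maximizer $(\hat\sigma_i)_{i=1}^{j-1}$ coincides with the maximizer for a larger $j'>j$ in the first $j-1$ components. (ii) The quantity $Q_j'(\mathbf{q}):=\sigma_jQ_j(\mathbf{q},\widehat{\boldsymbol{\sigma}})$ satisfies $Q_j'(\mathbf{q})\in\mathbb{R}$, $|Q_j'(\mathbf{q})|<1$ and $$\operatorname{sign}(Q_j'(\mathbf{q}))=\operatorname{sign}(q_j).$$ For given $\mathbf{q}\in[-q,q]^j$ and $\widehat{\boldsymbol{\sigma}}=(\hat\sigma_i)_{i=1}^j$ as in the context it holds $$\operatorname{sign}\left(Q_\ell(\mathbf{q},\widehat{\boldsymbol{\sigma}})\right)=\operatorname{sign}(q_{\ell+1})\qquad\forall\,1\le\ell\le j-1.$$ (iii) For any sequence $\tilde{\mathbf{q}}=(\tilde q_i)_{i=1}^j$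 such that $\tilde q_i\in\{-q,q\}$ and corresponding $\widehat{\boldsymbol{\sigma}}(\tilde{\mathbf{q}})$, the maximum over all $q_i\in[-q,q]$ is given by $$\max_{\mathbf{q}\in[-q,q]^j}\ \max_{\sigma_i\in\mathcal{C},\,1\le i\le j}|Q_j(\mathbf{q},\boldsymbol{\sigma})|=|Q_j(\tilde{\mathbf{q}},\widehat{\boldsymbol{\sigma}}(\tilde{\mathbf{q}}))|=\frac{(1+q)^j-(1-q)^j}{(1+q)^j+(1-q)^j}.$$
   Context: For $\mathbf{q}=(q_i)_{i=1}^j\in[-q,q]^j$ and $\boldsymbol{\sigma}=(\sigma_i)_{i=1}^j\in\mathcal{C}^j$ the numbers $Q_i=Q_i(\mathbf{q},\boldsymbol{\sigma})$ (depending only on the first $i$ components of $\mathbf{q}$ and $\boldsymbol{\sigma}$) are defined by $$Q_1=\frac{q_1}{\sigma_1},\qquad Q_i=\frac{q_i+Q_{i-1}}{\sigma_i(1+q_iQ_{i-1})},\quad2\le i\le j.$$ For given $\mathbf{q}$ and $\boldsymbol{\sigma}$, the vector $\widehat{\boldsymbol{\sigma}}=\widehat{\boldsymbol{\sigma}}(\mathbf{q},\boldsymbol{\sigma})=(\hat\sigma_1,\ldots,\hat\sigma_{j-1},\hat\sigma_j)$ is defined by $\hat\sigma_i:=\operatorname{sign}(q_iq_{i+1})\in\{-1,1\}$ for $1\le i\le j-1$ and $\hat\sigma_j:=\sigma_j$ (the modulus $|Q_j|$ and the quantity $\sigma_jQ_j$ do not depend on $\sigma_j$).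
   Formalization: With sign(0)=1, sign(q_i q_{i+1}) is read as sign(q_i)sign(q_{i+1}), since (i) and (ii) fail for some q with zero entries; the last claim of (ii) is stated when some q_i with i≤ℓ is nonzero, and otherwise Q_ℓ=0 is asserted. *)

theory Defs
  imports Complex_Main "HOL-Library.FuncSet"
begin

(* Vectors of length j are functions on nat of which only the values on {1..j} matter. *)

abbreviation unit_circle :: "complex set" where
  "unit_circle \<equiv> {z. cmod z = 1}"

(* The value at index 0 is a dummy.  The denominators never vanish when all \<bar>q i\<bar> < 1 and all
   \<sigma> i lie on the unit circle, since then \<bar>Q_i\<bar> < 1. *)
fun Q :: "(nat \<Rightarrow> real) \<Rightarrow> (nat \<Rightarrow> complex) \<Rightarrow> nat \<Rightarrow> complex" where
  "Q q \<sigma> 0 = 0"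
| "Q q \<sigma> (Suc 0) = of_real (q 1) / \<sigma> 1"
| "Q q \<sigma> (Suc (Suc i)) =
     (of_real (q (Suc (Suc i))) + Q q \<sigma> (Suc i)) /
     (\<sigma> (Suc (Suc i)) * (1 + of_real (q (Suc (Suc i))) * Q q \<sigma> (Suc i)))"

(* Unlike sgn, this takes values in {-1, 1} only. *)
definition sign :: "real \<Rightarrow> real" where
  "sign x = (if x \<ge> 0 then 1 else -1)"

(* sign (q i * q (i + 1)), where the sign of a product is read as the product of the signs.
   The two agree unless an entry is 0 (see sigma_hat_eq_sgn).  At 0 the distinction matters:
   no value of sign 0 in {-1, 1} makes sign (q i * q (i + 1)) a maximizer in general.
   For the vector (-a, 0, b) with a, b > 0 both values give \<bar>Q_3\<bar> = \<bar>b - a\<bar> / (1 - a * b),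
   whereas the maximum is (a + b) / (1 + a * b). *)
definition sigma_hat :: "nat \<Rightarrow> (nat \<Rightarrow> real) \<Rightarrow> (nat \<Rightarrow> complex) \<Rightarrow> nat \<Rightarrow> complex" where
  "sigma_hat j q \<sigma> i = (if i < j then of_real (sign (q i) * sign (q (i + 1))) else \<sigma> i)"

lemma sigma_hat_eq_sgn:
  assumes "i < j" "q i \<noteq> 0" "q (i + 1) \<noteq> 0"
  shows "sigma_hat j q \<sigma> i = of_real (sgn (q i * q (i + 1)))"
proof -
  have "sign x = sgn x" if "x \<noteq> 0" for x :: real
    using that by (simp add: sign_def sgn_if)
  with assms show ?thesis
    by (simp add: sigma_hat_def sgn_mult)
qed

definition Q' :: "nat \<Rightarrow> (nat \<Rightarrow> real) \<Rightarrow> (nat \<Rightarrow> complex) \<Rightarrow> complex" where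
  "Q' j q \<sigma> = \<sigma> j * Q q (sigma_hat j q \<sigma>) j"

(* Max is only meaningful on finite sets. *)
definition is_maximum :: "real set \<Rightarrow> real \<Rightarrow> bool" where
  "is_maximum S m \<longleftrightarrow> m \<in> S \<and> (\<forall>x\<in>S. x \<le> m)"

end

theory Submission
  imports Defs
begin

text \<open>
  For real arguments, \<open>(x, y) \<mapsto> (x + y) / (1 + x y)\<close> is the addition law of \<open>tanh\<close>. The modulus of
  \<open>(a + z) / (1 + a z)\<close> is largest, for \<open>z\<close> of fixed modulus, when \<open>z\<close> has the direction of \<open>a\<close>, and
  the choice of \<open>sigma_hat\<close> turns every \<open>Q\<^sub>i\<close> into the direction of \<open>q\<^sub>i\<^sub>+\<^sub>1\<close>. Hence the maximum
  over the \<open>\<sigma>\<^sub>i\<close> is the \<open>tanh\<close> of the sum of the \<open>artanh \<bar>q\<^sub>i\<bar>\<close>, which has a closed form in terms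
  of the products of \<open>1 + \<bar>q\<^sub>i\<bar>\<close> and of \<open>1 - \<bar>q\<^sub>i\<bar>\<close> and increases with each \<open>\<bar>q\<^sub>i\<bar>\<close>.
\<close>

section \<open>Moebius maps on the unit disc\<close>

lemma one_plus_mult_nonzero:
  fixes a :: real and z :: complex
  assumes "\<bar>a\<bar> < 1" "cmod z < 1"
  shows "1 + of_real a * z \<noteq> 0"
proof
  assume "1 + of_real a * z = 0"
  then have "of_real a * z = -1"
    by (simp add: add_eq_0_iff)
  then have "\<bar>a\<bar> * cmod z = 1"
    by (metis norm_minus_cancel norm_mult norm_of_real norm_one)
  moreover have "\<bar>a\<bar> * cmod z \<le> \<bar>a\<bar> * 1"
    using assms by (intro mult_left_mono) auto
  ultimately show False
    using assms by simp
qed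

text \<open>Here and in the next formula the direction of \<open>z\<close> enters only through the
  same summand \<open>2 * a * Re z\<close>.\<close>

lemma cmod_add_of_real_sq: "(cmod (of_real a + z))\<^sup>2 = a\<^sup>2 + (cmod z)\<^sup>2 + 2 * a * Re z"
  unfolding cmod_power2 by (simp add: power2_eq_square algebra_simps)

lemma cmod_one_plus_of_real_mult_sq:
  "(cmod (1 + of_real a * z))\<^sup>2 = 1 + a\<^sup>2 * (cmod z)\<^sup>2 + 2 * a * Re z"
  unfolding cmod_power2 by (simp add: power2_eq_square algebra_simps)

text \<open>For fixed \<open>cmod z\<close> the squared modulus is \<open>(u + s) / (v + s)\<close>
  with \<open>u \<le> v\<close>, which grows with \<open>s\<close>, and \<open>s\<close> is at most
  \<open>m\<close>.\<close>

lemma cmod_moebius_le: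
  fixes a :: real and z :: complex
  assumes "\<bar>a\<bar> < 1" "cmod z < 1"
  shows "cmod ((of_real a + z) / (1 + of_real a * z)) \<le> (\<bar>a\<bar> + cmod z) / (1 + \<bar>a\<bar> * cmod z)"
proof -
  define u v m s where "u = a\<^sup>2 + (cmod z)\<^sup>2" and "v = 1 + a\<^sup>2 * (cmod z)\<^sup>2"
    and "m = 2 * (\<bar>a\<bar> * cmod z)" and "s = 2 * a * Re z"
  have "a * Re z \<le> \<bar>a\<bar> * \<bar>Re z\<bar>"
    by (simp flip: abs_mult)
  also have "\<dots> \<le> \<bar>a\<bar> * cmod z"
    by (intro mult_left_mono abs_Re_le_cmod) simp
  finally have "a * Re z \<le> \<bar>a\<bar> * cmod z" .
  then have "s \<le> m"
    by (simp add: s_def m_def)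
  moreover have "0 \<le> (1 - a\<^sup>2) * (1 - (cmod z)\<^sup>2)"
    using assms by (intro mult_nonneg_nonneg) (auto simp: abs_square_le_1 power_le_one)
  then have "u \<le> v"
    by (simp add: u_def v_def algebra_simps)
  \<comment> \<open>The product is the difference of the two sides of
    \<open>(u + s) / (v + s) \<le> (u + m) / (v + m)\<close> after clearing denominators.\<close>
  ultimately have "0 \<le> (m - s) * (v - u)"
    by simp
  then have "(u + s) * (v + m) \<le> (u + m) * (v + s)"
    by (simp add: algebra_simps)
  moreover have "u + m = (\<bar>a\<bar> + cmod z)\<^sup>2" "v + m = (1 + \<bar>a\<bar> * cmod z)\<^sup>2"
    by (simp_all add: u_def v_def m_def power2_sum power_mult_distrib)
  moreover have "u + s = (cmod (of_real a + z))\<^sup>2" "v + s = (cmod (1 + of_real a * z))\<^sup>2"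
    by (simp_all add: u_def v_def s_def cmod_add_of_real_sq cmod_one_plus_of_real_mult_sq)
  ultimately have "(cmod (of_real a + z) * (1 + \<bar>a\<bar> * cmod z))\<^sup>2
      \<le> ((\<bar>a\<bar> + cmod z) * cmod (1 + of_real a * z))\<^sup>2"
    by (simp add: power_mult_distrib)
  then have "cmod (of_real a + z) * (1 + \<bar>a\<bar> * cmod z)
      \<le> (\<bar>a\<bar> + cmod z) * cmod (1 + of_real a * z)"
    by (rule power2_le_imp_le) simp
  moreover have "0 < cmod (1 + of_real a * z)"
    using one_plus_mult_nonzero[OF assms] by simp
  moreover have "0 < 1 + \<bar>a\<bar> * cmod z"
    by (simp add: add_pos_nonneg)
  ultimately show ?thesis
    by (simp add: norm_divide divide_simps)
qed

text \<open>Clearing denominators leaves the difference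
  \<open>(1 - a\<^sup>2) * (y - x)\<close>.\<close>

lemma tanh_add_mono:
  fixes a x y :: real
  assumes "0 \<le> a" "a \<le> 1" "0 \<le> x" "x \<le> y"
  shows "(a + x) / (1 + a * x) \<le> (a + y) / (1 + a * y)"
proof -
  have "0 < 1 + a * x" "0 < 1 + a * y"
    using assms by (simp_all add: add_pos_nonneg)
  moreover have "0 \<le> (1 - a\<^sup>2) * (y - x)"
    using assms by (simp add: power_le_one)
  ultimately show ?thesis
    by (simp add: divide_simps) (simp add: power2_eq_square algebra_simps)
qed

section \<open>The closed form of the maximum\<close>

text \<open>Since \<open>artanh x = ln ((1 + x) / (1 - x)) / 2\<close>, the sum of the
  \<open>artanh \<bar>q i\<bar>\<close> is \<open>ln (A / B) / 2\<close> for the two products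
  \<open>A\<close> and \<open>B\<close>, and its \<open>tanh\<close> is
  \<open>(A - B) / (A + B)\<close>.\<close>

definition max_Q :: "(nat \<Rightarrow> real) \<Rightarrow> nat \<Rightarrow> real" where
  "max_Q q n = ((\<Prod>i = 1..n. 1 + \<bar>q i\<bar>) - (\<Prod>i = 1..n. 1 - \<bar>q i\<bar>)) /
    ((\<Prod>i = 1..n. 1 + \<bar>q i\<bar>) + (\<Prod>i = 1..n. 1 - \<bar>q i\<bar>))"

lemma max_Q_0 [simp]: "max_Q q 0 = 0"
  by (simp add: max_Q_def)

lemma prod_one_plus_abs_pos: "0 < (\<Prod>i\<in>A. 1 + \<bar>q i :: real\<bar>)"
  by (intro prod_pos) (simp add: add_pos_nonneg)

lemma prod_one_minus_abs_pos:
  fixes q :: "'a \<Rightarrow> real"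
  assumes "\<forall>i\<in>A. \<bar>q i\<bar> < 1"
  shows "0 < (\<Prod>i\<in>A. 1 - \<bar>q i\<bar>)"
  using assms by (intro prod_pos) auto

lemma max_Q_Suc:
  assumes "\<forall>i\<in>{1..Suc n}. \<bar>q i\<bar> < 1"
  shows "max_Q q (Suc n) = (\<bar>q (Suc n)\<bar> + max_Q q n) / (1 + \<bar>q (Suc n)\<bar> * max_Q q n)"
proof -
  define A B a where "A = (\<Prod>i = 1..n. 1 + \<bar>q i\<bar>)" and "B = (\<Prod>i = 1..n. 1 - \<bar>q i\<bar>)"
    and "a = \<bar>q (Suc n)\<bar>"
  have "A + B > 0"
    unfolding A_def B_def
    by (intro add_pos_pos prod_one_plus_abs_pos prod_one_minus_abs_pos) (use assms in auto)
  then have AB: "A + B \<noteq> 0"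
    by simp
  have "max_Q q (Suc n) = (A * (1 + a) - B * (1 - a)) / (A * (1 + a) + B * (1 - a))"
    by (simp add: max_Q_def A_def B_def a_def)
  also have "\<dots> = (a * (A + B) + (A - B)) / ((A + B) + a * (A - B))"
    by (simp add: algebra_simps)
  \<comment> \<open>Dividing through by \<open>A + B\<close> brings out
    \<open>(A - B) / (A + B)\<close>, the value of \<open>max_Q q n\<close>.\<close>
  also have "\<dots> = ((a * (A + B) + (A - B)) / (A + B)) / (((A + B) + a * (A - B)) / (A + B))"
    using AB by simp
  also have "\<dots> = (a + (A - B) / (A + B)) / (1 + a * ((A - B) / (A + B)))"
    using AB by (simp add: add_divide_distrib)
  finally show ?thesis
    by (simp add: max_Q_def A_def B_def a_def)
qed

lemma max_Q_bounds:
  assumes "\<forall>i\<in>{1..n}. \<bar>q i\<bar> < 1"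
  shows "0 \<le> max_Q q n" "max_Q q n < 1"
proof -
  have "(\<Prod>i = 1..n. 1 - \<bar>q i\<bar>) \<le> (\<Prod>i = 1..n. 1 + \<bar>q i\<bar>)"
    using assms by (intro prod_mono) force
  then show "0 \<le> max_Q q n" "max_Q q n < 1"
    using prod_one_minus_abs_pos[of "{1..n}" q] prod_one_plus_abs_pos[of q "{1..n}"] assms
    by (simp_all add: max_Q_def)
qed

text \<open>Isolates the degenerate case of the sign statements: a factor \<open>sign x\<close>
  cannot be recovered from its product with 0.\<close>

lemma max_Q_eq_0_iff:
  assumes "\<forall>i\<in>{1..n}. \<bar>q i\<bar> < 1"
  shows "max_Q q n = 0 \<longleftrightarrow> (\<forall>i\<in>{1..n}. q i = 0)"
  using assms
proof (induction n)
  case (Suc n)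
  have "0 \<le> max_Q q n"
    using Suc.prems by (intro max_Q_bounds) auto
  then have "0 < 1 + \<bar>q (Suc n)\<bar> * max_Q q n"
    by (simp add: add_pos_nonneg)
  with \<open>0 \<le> max_Q q n\<close> have "max_Q q (Suc n) = 0 \<longleftrightarrow> q (Suc n) = 0 \<and> max_Q q n = 0"
    unfolding max_Q_Suc[OF Suc.prems] by (auto simp: add_nonneg_eq_0_iff)
  moreover have "max_Q q n = 0 \<longleftrightarrow> (\<forall>i\<in>{1..n}. q i = 0)"
    using Suc.prems by (intro Suc.IH) auto
  ultimately show ?case
    by (auto simp: atLeastAtMostSuc_conv)
qed simp

text \<open>\<open>(A - B) / (A + B)\<close> increases with \<open>A\<close> and decreases with
  \<open>B\<close>; larger \<open>\<bar>q i\<bar>\<close> raise \<open>A\<close> and lower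
  \<open>B\<close>.\<close>

lemma max_Q_mono:
  assumes le: "\<forall>i\<in>{1..n}. \<bar>p i\<bar> \<le> \<bar>q i\<bar>" and q: "\<forall>i\<in>{1..n}. \<bar>q i\<bar> < 1"
  shows "max_Q p n \<le> max_Q q n"
proof -
  define A B A' B' where "A = (\<Prod>i = 1..n. 1 + \<bar>p i\<bar>)" and "B = (\<Prod>i = 1..n. 1 - \<bar>p i\<bar>)"
    and "A' = (\<Prod>i = 1..n. 1 + \<bar>q i\<bar>)" and "B' = (\<Prod>i = 1..n. 1 - \<bar>q i\<bar>)"
  have "A \<le> A'" "B' \<le> B"
    unfolding A_def A'_def B_def B'_def
    using le q by (auto intro!: prod_mono simp: less_imp_le)
  moreover have pos: "0 < A" "0 < A'" "0 < B'"
    unfolding A_def A'_def B'_def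
    using q by (auto intro!: prod_one_plus_abs_pos prod_one_minus_abs_pos)
  ultimately have "A * B' \<le> A' * B"
    by (intro mult_mono) auto
  then have "(A - B) * (A' + B') \<le> (A' - B') * (A + B)"
    by (simp add: algebra_simps)
  moreover have "0 < A + B" "0 < A' + B'"
    using pos \<open>B' \<le> B\<close> by auto
  ultimately have "(A - B) / (A + B) \<le> (A' - B') / (A' + B')"
    by (simp add: divide_simps)
  then show ?thesis
    by (simp add: max_Q_def A_def B_def A'_def B'_def)
qed

lemma max_Q_const:
  assumes "\<forall>i\<in>{1..n}. \<bar>p i\<bar> = c"
  shows "max_Q p n = ((1 + c) ^ n - (1 - c) ^ n) / ((1 + c) ^ n + (1 - c) ^ n)"
proof -
  have "(\<Prod>i = 1..n. 1 + \<bar>p i\<bar>) = (\<Prod>i = 1..n. 1 + c)" "(\<Prod>i = 1..n. 1 - \<bar>p i\<bar>) = (\<Prod>i = 1..n. 1 - c)"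
    using assms by (auto intro!: prod.cong)
  then show ?thesis
    by (simp add: max_Q_def)
qed

section \<open>The upper bound for all choices on the unit circle\<close>

text \<open>The dummy value 0 at index 0 makes the general recursion hold at index 1 too, so
  inductions can start at 0.\<close>

lemma Q_Suc:
  "Q q \<sigma> (Suc n) = (of_real (q (Suc n)) + Q q \<sigma> n) / (\<sigma> (Suc n) * (1 + of_real (q (Suc n)) * Q q \<sigma> n))"
  by (cases n) auto

text \<open>The factor \<open>\<tau> (Suc n)\<close> drops out of the modulus;
  \<open>cmod_moebius_le\<close> then bounds one step, and \<open>tanh_add_mono\<close> admits the
  induction hypothesis.\<close>

lemma cmod_Q_le:
  assumes "\<forall>i\<in>{1..n}. \<bar>q i\<bar> < 1" and "\<forall>i\<in>{1..n}. cmod (\<tau> i) = 1"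
  shows "cmod (Q q \<tau> n) \<le> max_Q q n"
  using assms
proof (induction n)
  case (Suc n)
  have le: "cmod (Q q \<tau> n) \<le> max_Q q n"
    using Suc.prems by (intro Suc.IH) auto
  moreover have "max_Q q n < 1"
    using Suc.prems by (intro max_Q_bounds) auto
  ultimately have lt: "cmod (Q q \<tau> n) < 1"
    by simp
  have a: "\<bar>q (Suc n)\<bar> < 1" and \<tau>: "cmod (\<tau> (Suc n)) = 1"
    using Suc.prems by auto
  have "cmod (Q q \<tau> (Suc n))
      = cmod ((of_real (q (Suc n)) + Q q \<tau> n) / (1 + of_real (q (Suc n)) * Q q \<tau> n))"
    unfolding Q_Suc using \<tau> by (simp add: norm_divide norm_mult)
  also have "\<dots> \<le> (\<bar>q (Suc n)\<bar> + cmod (Q q \<tau> n)) / (1 + \<bar>q (Suc n)\<bar> * cmod (Q q \<tau> n))"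
    using a lt by (rule cmod_moebius_le)
  also have "\<dots> \<le> (\<bar>q (Suc n)\<bar> + max_Q q n) / (1 + \<bar>q (Suc n)\<bar> * max_Q q n)"
    using a le by (intro tanh_add_mono) auto
  also have "\<dots> = max_Q q (Suc n)"
    using Suc.prems by (intro max_Q_Suc[symmetric]) auto
  finally show ?case .
qed simp

section \<open>Equality at \<open>sigma_hat\<close>\<close>

lemma abs_sign [simp]: "\<bar>sign x\<bar> = 1"
  by (simp add: sign_def)

text \<open>Strict positivity matters: as \<open>sign 0 = 1\<close>, the case \<open>r = 0\<close>
  fails for negative \<open>x\<close>.\<close>

lemma sign_sign_mult_pos:
  assumes "0 < r"
  shows "sign (sign x * r) = sign x"
  using assms by (simp add: sign_def)

text \<open>With \<open>a = sign a * \<bar>a\<bar>\<close>, this is the oddness of the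
  \<open>tanh\<close> addition law.\<close>

lemma tanh_add_sign:
  "(a + sign a * r) / (1 + a * (sign a * r)) = sign a * ((\<bar>a\<bar> + r) / (1 + \<bar>a\<bar> * r))"
  by (simp add: sign_def)

text \<open>Leaving \<open>\<tau>\<close> arbitrary covers both the indices below \<open>j\<close>
  and \<open>j\<close> itself, where \<open>sigma_hat\<close> is defined differently.\<close>

lemma Q_Suc_sigma_hat:
  assumes "\<forall>i\<in>{1..Suc n}. \<bar>q i\<bar> < 1"
    and "Q q \<tau> n = of_real (sign (q (Suc n)) * max_Q q n)"
  shows "Q q \<tau> (Suc n) = of_real (sign (q (Suc n)) * max_Q q (Suc n)) / \<tau> (Suc n)"
proof -
  have "Q q \<tau> (Suc n) = of_real ((q (Suc n) + sign (q (Suc n)) * max_Q q n) /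
      (1 + q (Suc n) * (sign (q (Suc n)) * max_Q q n))) / \<tau> (Suc n)"
    unfolding Q_Suc assms(2) by simp
  then show ?thesis
    unfolding tanh_add_sign max_Q_Suc[OF assms(1)] by simp
qed

text \<open>The invariant behind equality: each value is real and aligned with the next entry of
  \<open>q\<close>, so every step attains the bound.\<close>

lemma Q_sigma_hat_less:
  assumes "\<forall>i\<in>{1..n}. \<bar>q i\<bar> < 1" and "n < j"
  shows "Q q (sigma_hat j q \<sigma>) n = of_real (sign (q (Suc n)) * max_Q q n)"
  using assms
proof (induction n)
  case (Suc n)
  have "Q q (sigma_hat j q \<sigma>) n = of_real (sign (q (Suc n)) * max_Q q n)"
    using Suc.prems by (intro Suc.IH) auto
  then have "Q q (sigma_hat j q \<sigma>) (Suc n)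
      = of_real (sign (q (Suc n)) * max_Q q (Suc n)) / sigma_hat j q \<sigma> (Suc n)"
    using Suc.prems by (intro Q_Suc_sigma_hat) auto
  also have "\<dots> = of_real (sign (q (Suc n)) * max_Q q (Suc n) / (sign (q (Suc n)) * sign (q (Suc (Suc n)))))"
    using Suc.prems by (simp add: sigma_hat_def)
  \<comment> \<open>Signs are their own inverses: the old sign cancels and the next one takes its
    place.\<close>
  also have "\<dots> = of_real (sign (q (Suc (Suc n))) * max_Q q (Suc n))"
    by (simp add: sign_def)
  finally show ?case .
qed simp

lemma Q_sigma_hat:
  assumes "\<forall>i\<in>{1..j}. \<bar>q i\<bar> < 1" and "1 \<le> j"
  shows "Q q (sigma_hat j q \<sigma>) j = of_real (sign (q j) * max_Q q j) / \<sigma> j"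
proof -
  obtain n where j: "j = Suc n"
    using \<open>1 \<le> j\<close> by (cases j) auto
  have "Q q (sigma_hat j q \<sigma>) n = of_real (sign (q (Suc n)) * max_Q q n)"
    using assms j by (intro Q_sigma_hat_less) auto
  then have "Q q (sigma_hat j q \<sigma>) (Suc n)
      = of_real (sign (q (Suc n)) * max_Q q (Suc n)) / sigma_hat j q \<sigma> (Suc n)"
    using assms j by (intro Q_Suc_sigma_hat) auto
  then show ?thesis
    by (simp add: j sigma_hat_def)
qed

lemma cmod_Q_sigma_hat:
  assumes "\<forall>i\<in>{1..j}. \<bar>q i\<bar> < 1" and "1 \<le> j" and "cmod (\<sigma> j) = 1"
  shows "cmod (Q q (sigma_hat j q \<sigma>) j) = max_Q q j"
  unfolding Q_sigma_hat[OF assms(1,2)] norm_divide norm_of_real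
  using max_Q_bounds(1)[of j q] assms by (simp add: abs_mult)

section \<open>Maxima and signs\<close>

lemma sigma_hat_in_unit_circle:
  assumes "\<sigma> \<in> {1..j} \<rightarrow> unit_circle"
  shows "sigma_hat j q \<sigma> \<in> {1..j} \<rightarrow> unit_circle"
  using assms by (auto simp: sigma_hat_def norm_mult Pi_iff)

lemma is_maximum_unique: "is_maximum S x \<Longrightarrow> is_maximum S y \<Longrightarrow> x = y"
  unfolding is_maximum_def by (meson order_antisym)

lemma is_maximum_sigma_hat:
  assumes "\<forall>i\<in>{1..j}. \<bar>q i\<bar> < 1" and "1 \<le> j" and "\<sigma> \<in> {1..j} \<rightarrow> unit_circle"
  shows "is_maximum ((\<lambda>\<tau>. cmod (Q q \<tau> j)) ` ({1..j} \<rightarrow> unit_circle))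
    (cmod (Q q (sigma_hat j q \<sigma>) j))"
proof -
  have "cmod (\<sigma> j) = 1"
    using assms(2,3) by auto
  then have "cmod (Q q \<tau> j) \<le> cmod (Q q (sigma_hat j q \<sigma>) j)"
    if "\<tau> \<in> {1..j} \<rightarrow> unit_circle" for \<tau>
    using cmod_Q_le[of j q \<tau>] cmod_Q_sigma_hat[of j q \<sigma>] assms that by (auto simp: Pi_iff)
  then show ?thesis
    using sigma_hat_in_unit_circle[OF assms(3), of q] by (auto simp: is_maximum_def)
qed

text \<open>Replaces the inner maximum by a number, which reduces the double maximum to maximizing
  \<open>max_Q\<close> over the box.\<close>

lemma is_maximum_iff_max_Q:
  assumes "\<forall>i\<in>{1..j}. \<bar>q i\<bar> < 1" and "1 \<le> j"
  shows "is_maximum ((\<lambda>\<tau>. cmod (Q q \<tau> j)) ` ({1..j} \<rightarrow> unit_circle)) m \<longleftrightarrow> m = max_Q q j"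
proof -
  have "is_maximum ((\<lambda>\<tau>. cmod (Q q \<tau> j)) ` ({1..j} \<rightarrow> unit_circle)) (max_Q q j)"
    \<comment> \<open>The constant 1 serves as an arbitrary point of the feasible set.\<close>
    using is_maximum_sigma_hat[of j q "\<lambda>_. 1"] cmod_Q_sigma_hat[of j q "\<lambda>_. 1"] assms by simp
  then show ?thesis
    using is_maximum_unique by blast
qed

lemma Q'_eq:
  assumes "\<forall>i\<in>{1..j}. \<bar>q i\<bar> < 1" and "1 \<le> j" and "cmod (\<sigma> j) = 1"
  shows "Q' j q \<sigma> = of_real (sign (q j) * max_Q q j)"
  using assms(3) by (auto simp: Q'_def Q_sigma_hat[OF assms(1,2)])

lemma sign_mult_max_Q:
  assumes "\<forall>i\<in>{1..j}. \<bar>q i\<bar> < 1" and "1 \<le> j"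
  shows "sign (sign (q j) * max_Q q j) = sign (q j)"
proof (cases "max_Q q j = 0")
  case True
  then have "q j = 0"
    using max_Q_eq_0_iff[of j q] assms by auto
  with True show ?thesis
    by simp
next
  case False
  then have "0 < max_Q q j"
    using max_Q_bounds(1)[of j q] assms(1) by force
  then show ?thesis
    by (rule sign_sign_mult_pos)
qed

theorem lemma15:
  fixes q :: real and j :: nat
  assumes "0 < q" "q < 1" "j \<ge> 1"
  shows
    "(\<forall>qs \<in> {1..j} \<rightarrow> {-q..q}. \<forall>\<sigma> \<in> {1..j} \<rightarrow> unit_circle.
        sigma_hat j qs \<sigma> \<in> {1..j} \<rightarrow> unit_circle \<and>
        is_maximum ((\<lambda>\<tau>. cmod (Q qs \<tau> j)) ` ({1..j} \<rightarrow> unit_circle))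
          (cmod (Q qs (sigma_hat j qs \<sigma>) j)) \<and>
        (\<forall>j' > j. \<forall>qs' \<in> {1..j'} \<rightarrow> {-q..q}. \<forall>\<sigma>' \<in> {1..j'} \<rightarrow> unit_circle.
           (\<forall>i \<in> {1..j}. qs' i = qs i) \<longrightarrow>
           is_maximum ((\<lambda>\<tau>. cmod (Q qs' \<tau> j')) ` ({1..j'} \<rightarrow> unit_circle))
             (cmod (Q qs' (sigma_hat j' qs' \<sigma>') j')) \<and>
           (\<forall>i \<in> {1..<j}. sigma_hat j' qs' \<sigma>' i = sigma_hat j qs \<sigma> i))) \<and>
     (\<forall>qs \<in> {1..j} \<rightarrow> {-q..q}. \<forall>\<sigma> \<in> {1..j} \<rightarrow> unit_circle.
        Q' j qs \<sigma> \<in> \<real> \<and> cmod (Q' j qs \<sigma>) < 1 \<and> sign (Re (Q' j qs \<sigma>)) = sign (qs j) \<and>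
        (\<forall>l \<in> {1..<j}.
           Q qs (sigma_hat j qs \<sigma>) l \<in> \<real> \<and>
           ((\<exists>i \<in> {1..l}. qs i \<noteq> 0) \<longrightarrow>
              sign (Re (Q qs (sigma_hat j qs \<sigma>) l)) = sign (qs (l + 1))) \<and>
           ((\<forall>i \<in> {1..l}. qs i = 0) \<longrightarrow> Q qs (sigma_hat j qs \<sigma>) l = 0))) \<and>
     (\<forall>qt \<in> {1..j} \<rightarrow> {-q, q}. \<forall>\<sigma> \<in> {1..j} \<rightarrow> unit_circle.
        is_maximum
          {m. \<exists>qs \<in> {1..j} \<rightarrow> {-q..q}.
                is_maximum ((\<lambda>\<tau>. cmod (Q qs \<tau> j)) ` ({1..j} \<rightarrow> unit_circle)) m}
          (cmod (Q qt (sigma_hat j qt \<sigma>) j)) \<and>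
        cmod (Q qt (sigma_hat j qt \<sigma>) j) =
          ((1 + q) ^ j - (1 - q) ^ j) / ((1 + q) ^ j + (1 - q) ^ j))"
proof (intro conjI ballI allI impI)
  have lt: "\<forall>i\<in>{1..n}. \<bar>p i\<bar> < 1" if "p \<in> {1..n} \<rightarrow> {-q..q}" for p :: "nat \<Rightarrow> real" and n
    using Pi_mem[OF that] \<open>q < 1\<close> by force
  {
    fix qs \<sigma>
    assume qs: "qs \<in> {1..j} \<rightarrow> {-q..q}" and \<sigma>: "\<sigma> \<in> {1..j} \<rightarrow> unit_circle"
    show "sigma_hat j qs \<sigma> \<in> {1..j} \<rightarrow> unit_circle"
      using \<sigma> by (rule sigma_hat_in_unit_circle)
    show "is_maximum ((\<lambda>\<tau>. cmod (Q qs \<tau> j)) ` ({1..j} \<rightarrow> unit_circle))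
        (cmod (Q qs (sigma_hat j qs \<sigma>) j))"
      using lt[OF qs] \<open>j \<ge> 1\<close> \<sigma> by (rule is_maximum_sigma_hat)
    have \<sigma>j: "cmod (\<sigma> j) = 1"
      using \<sigma> \<open>j \<ge> 1\<close> by auto
    note Q' = Q'_eq[where \<sigma> = \<sigma>, OF lt[OF qs] \<open>j \<ge> 1\<close> \<sigma>j]
    show "Q' j qs \<sigma> \<in> \<real>"
      by (simp add: Q')
    show "cmod (Q' j qs \<sigma>) < 1"
      unfolding Q' norm_of_real
      using max_Q_bounds[of j qs] lt[OF qs] by (simp add: abs_mult)
    show "sign (Re (Q' j qs \<sigma>)) = sign (qs j)"
      unfolding Q' Re_complex_of_real using lt[OF qs] \<open>j \<ge> 1\<close> by (rule sign_mult_max_Q)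
    fix l
    assume l: "l \<in> {1..<j}"
    have lt_l: "\<forall>i\<in>{1..l}. \<bar>qs i\<bar> < 1"
      using lt[OF qs] l by auto
    have Ql: "Q qs (sigma_hat j qs \<sigma>) l = of_real (sign (qs (l + 1)) * max_Q qs l)"
      using Q_sigma_hat_less[OF lt_l, of j \<sigma>] l by simp
    show "Q qs (sigma_hat j qs \<sigma>) l \<in> \<real>"
      by (simp add: Ql)
    show "Q qs (sigma_hat j qs \<sigma>) l = 0" if "\<forall>i\<in>{1..l}. qs i = 0"
      using that max_Q_eq_0_iff[OF lt_l] by (simp add: Ql)
    \<comment> \<open>\<open>qs (l + 1)\<close> is not among the entries of
      \<open>max_Q qs l\<close>, so positivity has to come from a nonzero earlier entry.\<close>
    show "sign (Re (Q qs (sigma_hat j qs \<sigma>) l)) = sign (qs (l + 1))" if "\<exists>i\<in>{1..l}. qs i \<noteq> 0"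
    proof -
      have "max_Q qs l \<noteq> 0" "0 \<le> max_Q qs l"
        using that max_Q_eq_0_iff[OF lt_l] max_Q_bounds(1)[OF lt_l] by auto
      then have "0 < max_Q qs l"
        by simp
      then show ?thesis
        unfolding Ql Re_complex_of_real by (rule sign_sign_mult_pos)
    qed
  }
  {
    fix qs \<sigma> j' qs' \<sigma>'
    assume "j < j'" and qs': "qs' \<in> {1..j'} \<rightarrow> {-q..q}" and \<sigma>': "\<sigma>' \<in> {1..j'} \<rightarrow> unit_circle"
      and eq: "\<forall>i\<in>{1..j}. qs' i = qs i"
    have "1 \<le> j'"
      using \<open>j < j'\<close> by simp
    show "is_maximum ((\<lambda>\<tau>. cmod (Q qs' \<tau> j')) ` ({1..j'} \<rightarrow> unit_circle))
        (cmod (Q qs' (sigma_hat j' qs' \<sigma>') j'))"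
      using lt[OF qs'] \<open>1 \<le> j'\<close> \<sigma>' by (rule is_maximum_sigma_hat)
    \<comment> \<open>Only the entries \<open>i\<close> and \<open>i + 1\<close> are involved, and
      \<open>i + 1 \<le> j\<close> keeps both where the vectors agree.\<close>
    show "sigma_hat j' qs' \<sigma>' i = sigma_hat j qs \<sigma> i" if "i \<in> {1..<j}" for i
      using that eq \<open>j < j'\<close> by (simp add: sigma_hat_def)
  }
  fix qt \<sigma>
  assume qt: "qt \<in> {1..j} \<rightarrow> {-q, q}" and \<sigma>: "\<sigma> \<in> {1..j} \<rightarrow> unit_circle"
  have qt': "qt \<in> {1..j} \<rightarrow> {-q..q}"
    using \<open>0 < q\<close> by (intro subsetD[OF Pi_mono qt]) auto
  have abs_qt: "\<forall>i\<in>{1..j}. \<bar>qt i\<bar> = q"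
    using Pi_mem[OF qt] \<open>0 < q\<close> by fastforce
  have cmod_Q: "cmod (Q qt (sigma_hat j qt \<sigma>) j) = max_Q qt j"
    using lt[OF qt'] \<open>j \<ge> 1\<close> \<sigma> by (intro cmod_Q_sigma_hat) auto
  show "cmod (Q qt (sigma_hat j qt \<sigma>) j) =
      ((1 + q) ^ j - (1 - q) ^ j) / ((1 + q) ^ j + (1 - q) ^ j)"
    unfolding cmod_Q using abs_qt by (rule max_Q_const)
  \<comment> \<open>Each entry of \<open>qt\<close> has the largest modulus that the box
    allows.\<close>
  have "max_Q qs j \<le> max_Q qt j" if "qs \<in> {1..j} \<rightarrow> {-q..q}" for qs
  proof (rule max_Q_mono)
    show "\<forall>i\<in>{1..j}. \<bar>qs i\<bar> \<le> \<bar>qt i\<bar>"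
      using Pi_mem[OF that] abs_qt by force
  qed (rule lt[OF qt'])
  moreover have max_iff: "is_maximum ((\<lambda>\<tau>. cmod (Q qs \<tau> j)) ` ({1..j} \<rightarrow> unit_circle)) m \<longleftrightarrow> m = max_Q qs j"
    if "qs \<in> {1..j} \<rightarrow> {-q..q}" for qs m
    using lt[OF that] \<open>j \<ge> 1\<close> by (rule is_maximum_iff_max_Q)
  ultimately have "is_maximum {m. \<exists>qs \<in> {1..j} \<rightarrow> {-q..q}. m = max_Q qs j} (max_Q qt j)"
    using qt' by (auto simp: is_maximum_def)
  with max_iff show "is_maximum
      {m. \<exists>qs \<in> {1..j} \<rightarrow> {-q..q}.
            is_maximum ((\<lambda>\<tau>. cmod (Q qs \<tau> j)) ` ({1..j} \<rightarrow> unit_circle)) m}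
      (cmod (Q qt (sigma_hat j qt \<sigma>) j))"
    unfolding cmod_Q by (simp cong: bex_cong)
qed

end
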